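(* Let $(Z,r)$ be the twisted union of two solutions $(X,u)$ and $(Y,v)$ via $f,\alpha:X\to X$ and $g,\beta:Y\to Y$. Let $\kappa$ be a reflection for $(X,u)$ and $\kappa'$ a reflection for $(Y,v)$. Then the map $\omega:Z\to Z$ defined by $\omega(a)=\kappa(a)$ if $a\in X$ and $\omega(a)=\kappa'(a)$ if $a\in Y$ is a reflection for $(Z,r)$ if and only if $\kappa(f\alpha)=(f\alpha)\kappa$ and $\kappa'(g\beta)=(g\beta)\kappa'$.
   Context: A (set-theoretic) solution (of the Yang-Baxter equation) is a pair $(X,r)$ with $X$ a set and $r:X\times X\to X\times X$ a map satisfying $(r\times \mathrm{id}_X)(\mathrm{id}_X\times r)(r\times \mathrm{id}_X)=(\mathrm{id}_X\times r)(r\times \mathrm{id}_X)(\mathrm{id}_X\times r)$; write $r(x,y)=(\lambda_x(y),\rho_y(x))$. A reflection for $(X,r)$ is a map $\kappa:X\to X$ with $r(\mathrm{id}_X\times\kappa)r(\mathrm{id}_X\times\kappa)=(\mathrm{id}_X\times\kappa)r(\mathrm{id}_X\times\kappa)r$. Juxtaposition of maps denotes composition. Twisted union: let $(X,u)$, $(Y,v)$ be solutions and $f,\alpha:X\to X$, $g,\beta:Y\to Y$ maps such that for all $x\in X$, $y\in Y$: $\alpha f=f\alpha$, $g\beta=\beta g$, $(f\times f)u=u(f\times f)$, $(g\times g)v=v(g\times g)$, $(\alpha\times\alpha)u=u(\alpha\times\alpha)$, $(\beta\times\beta)v=v(\beta\times\beta)$, $\alpha\lambda_{f(x)}=\lambda_x\alpha$,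 $\beta\rho_{g(y)}=\rho_y\beta$, $f\rho_{\alpha(x)}=\rho_xf$, $g\lambda_{\beta(y)}=\lambda_yg$ (where $\lambda_x,\rho_x$ come from $u$ and $\lambda_y,\rho_y$ from $v$). The twisted union of $(X,u)$ and $(Y,v)$ via $f,\alpha$ and $g,\beta$ is the solution $(Z,r)$ on the disjoint union $Z=X\sqcup Y$ with $r(a,b)=u(a,b)$ if $a,b\in X$; $r(a,b)=v(a,b)$ if $a,b\in Y$; $r(a,b)=(g(b),f(a))$ if $a\in X,b\in Y$; $r(a,b)=(\alpha(b),\beta(a))$ if $a\in Y,b\in X$. *)

theory Defs
  imports Main
begin

text \<open>
  The underlying set of a solution is rendered as a type (hence nonempty), and the disjoint
  union of two such sets as their sum type.
\<close>

definition act12 :: "('a \<times> 'a \<Rightarrow> 'a \<times> 'a) \<Rightarrow> 'a \<times> 'a \<times> 'a \<Rightarrow> 'a \<times> 'a \<times> 'a" where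
  \<comment> \<open>\<open>r \<times> id\<close>, with triples re-bracketed to the right\<close>
  "act12 r = (\<lambda>(x, y, z). (fst (r (x, y)), snd (r (x, y)), z))"

definition act23 :: "('a \<times> 'a \<Rightarrow> 'a \<times> 'a) \<Rightarrow> 'a \<times> 'a \<times> 'a \<Rightarrow> 'a \<times> 'a \<times> 'a" where
  "act23 r = map_prod id r"

definition solution :: "('a \<times> 'a \<Rightarrow> 'a \<times> 'a) \<Rightarrow> bool" where
  "solution r \<longleftrightarrow> act12 r \<circ> act23 r \<circ> act12 r = act23 r \<circ> act12 r \<circ> act23 r"

text \<open>\<open>r (x, y) = (lam r x y, rho r y x)\<close>; note the argument order of \<open>rho\<close>.\<close>

definition lam :: "('a \<times> 'a \<Rightarrow> 'a \<times> 'a) \<Rightarrow> 'a \<Rightarrow> 'a \<Rightarrow> 'a" where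
  "lam r x y = fst (r (x, y))"

definition rho :: "('a \<times> 'a \<Rightarrow> 'a \<times> 'a) \<Rightarrow> 'a \<Rightarrow> 'a \<Rightarrow> 'a" where
  "rho r y x = snd (r (x, y))"

definition reflection :: "('a \<times> 'a \<Rightarrow> 'a \<times> 'a) \<Rightarrow> ('a \<Rightarrow> 'a) \<Rightarrow> bool" where
  "reflection r \<kappa> \<longleftrightarrow>
     r \<circ> map_prod id \<kappa> \<circ> r \<circ> map_prod id \<kappa> = map_prod id \<kappa> \<circ> r \<circ> map_prod id \<kappa> \<circ> r"

definition twisted_union_data ::
    "('a \<times> 'a \<Rightarrow> 'a \<times> 'a) \<Rightarrow> ('b \<times> 'b \<Rightarrow> 'b \<times> 'b) \<Rightarrow>
     ('a \<Rightarrow> 'a) \<Rightarrow> ('a \<Rightarrow> 'a) \<Rightarrow> ('b \<Rightarrow> 'b) \<Rightarrow> ('b \<Rightarrow> 'b) \<Rightarrow> bool" where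
  "twisted_union_data u v f \<alpha> g \<beta> \<longleftrightarrow>
     solution u \<and> solution v \<and>
     \<alpha> \<circ> f = f \<circ> \<alpha> \<and> g \<circ> \<beta> = \<beta> \<circ> g \<and>
     map_prod f f \<circ> u = u \<circ> map_prod f f \<and> map_prod g g \<circ> v = v \<circ> map_prod g g \<and>
     map_prod \<alpha> \<alpha> \<circ> u = u \<circ> map_prod \<alpha> \<alpha> \<and> map_prod \<beta> \<beta> \<circ> v = v \<circ> map_prod \<beta> \<beta> \<and>
     (\<forall>x. \<alpha> \<circ> lam u (f x) = lam u x \<circ> \<alpha>) \<and> (\<forall>y. \<beta> \<circ> rho v (g y) = rho v y \<circ> \<beta>) \<and>
     (\<forall>x. f \<circ> rho u (\<alpha> x) = rho u x \<circ> f) \<and> (\<forall>y. g \<circ> lam v (\<beta> y) = lam v y \<circ> g)"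

fun twisted_union ::
    "('a \<times> 'a \<Rightarrow> 'a \<times> 'a) \<Rightarrow> ('b \<times> 'b \<Rightarrow> 'b \<times> 'b) \<Rightarrow>
     ('a \<Rightarrow> 'a) \<Rightarrow> ('a \<Rightarrow> 'a) \<Rightarrow> ('b \<Rightarrow> 'b) \<Rightarrow> ('b \<Rightarrow> 'b) \<Rightarrow>
     ('a + 'b) \<times> ('a + 'b) \<Rightarrow> ('a + 'b) \<times> ('a + 'b)" where
  "twisted_union u v f \<alpha> g \<beta> (Inl a, Inl b) = map_prod Inl Inl (u (a, b))"
| "twisted_union u v f \<alpha> g \<beta> (Inr a, Inr b) = map_prod Inr Inr (v (a, b))"
| "twisted_union u v f \<alpha> g \<beta> (Inl a, Inr b) = (Inr (g b), Inl (f a))"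
| "twisted_union u v f \<alpha> g \<beta> (Inr a, Inl b) = (Inl (\<alpha> b), Inr (\<beta> a))"

lemma solution_twisted_union:
  assumes "twisted_union_data u v f \<alpha> g \<beta>"
  shows "solution (twisted_union u v f \<alpha> g \<beta>)"
proof -
  let ?r = "twisted_union u v f \<alpha> g \<beta>"
  have ybe: "act12 u (act23 u (act12 u (a, b, c))) = act23 u (act12 u (act23 u (a, b, c)))"
    "act12 v (act23 v (act12 v (a', b', c'))) = act23 v (act12 v (act23 v (a', b', c')))"
    for a b c a' b' c'
    using assms by (auto simp: twisted_union_data_def solution_def fun_eq_iff)
  have comm: "\<alpha> (f x) = f (\<alpha> x)" "g (\<beta> y) = \<beta> (g y)" for x y
    using assms by (auto simp: twisted_union_data_def fun_eq_iff)
  have hom: "u (f x, f x') = map_prod f f (u (x, x'))" "v (g y, g y') = map_prod g g (v (y, y'))"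
    "u (\<alpha> x, \<alpha> x') = map_prod \<alpha> \<alpha> (u (x, x'))"
    "v (\<beta> y, \<beta> y') = map_prod \<beta> \<beta> (v (y, y'))" for x x' y y'
    using assms by (auto simp: twisted_union_data_def fun_eq_iff)
  have mixed: "\<alpha> (fst (u (f x, x'))) = fst (u (x, \<alpha> x'))"
    "\<beta> (snd (v (y', g y))) = snd (v (\<beta> y', y))"
    "f (snd (u (x', \<alpha> x))) = snd (u (f x', x))"
    "g (fst (v (\<beta> y, y'))) = fst (v (y, g y'))" for x x' y y'
    using assms by (auto simp: twisted_union_data_def fun_eq_iff lam_def rho_def)
  have "act12 ?r (act23 ?r (act12 ?r (p, q, s))) = act23 ?r (act12 ?r (act23 ?r (p, q, s)))"
    for p q s
    using ybe comm hom mixed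
    by (cases p; cases q; cases s)
       (simp_all add: act12_def act23_def map_prod_def split_beta prod_eq_iff)
  then show ?thesis
    by (simp add: solution_def fun_eq_iff)
qed

end

theory Submission imports Defs begin

text \<open>
  Both sides of the reflection equation preserve the two blocks of \<open>Z \<times> Z\<close> on which the
  arguments lie in the same part, and there the equation is the one for \<open>\<kappa>\<close> or for \<open>\<kappa>'\<close>. On
  a mixed pair \<open>(a, b)\<close> with \<open>a\<close> in \<open>X\<close> the twisted union swaps the two parts, and two
  applications of it bring each argument back to its own place: both sides have the first
  component \<open>\<alpha> (\<kappa> (f a))\<close>, since \<open>\<kappa>\<close> acts on \<open>a\<close> exactly once, between \<open>f\<close> and \<open>\<alpha>\<close>, while
  their second components differ in whether \<open>\<kappa>'\<close> acts on \<open>b\<close> before or after \<open>\<beta> g\<close>. Hence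
  equality on this block says that \<open>\<kappa>'\<close> commutes with \<open>g \<beta> = \<beta> g\<close>; the opposite mixed block
  says the same of \<open>\<kappa>\<close> and \<open>f \<alpha>\<close>.
\<close>

lemma reflection_iff:
  "reflection r \<kappa> \<longleftrightarrow>
     (\<forall>p. r (map_prod id \<kappa> (r (map_prod id \<kappa> p))) = map_prod id \<kappa> (r (map_prod id \<kappa> (r p))))"
  by (simp add: reflection_def fun_eq_iff del: split_paired_All)

theorem theorem5p15:
  fixes u :: "'a \<times> 'a \<Rightarrow> 'a \<times> 'a" and v :: "'b \<times> 'b \<Rightarrow> 'b \<times> 'b"
    and f \<alpha> \<kappa> :: "'a \<Rightarrow> 'a" and g \<beta> \<kappa>' :: "'b \<Rightarrow> 'b"
  assumes "twisted_union_data u v f \<alpha> g \<beta>"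
    and "reflection u \<kappa>"
    and "reflection v \<kappa>'"
  shows "reflection (twisted_union u v f \<alpha> g \<beta>) (map_sum \<kappa> \<kappa>') \<longleftrightarrow>
    \<kappa> \<circ> (f \<circ> \<alpha>) = (f \<circ> \<alpha>) \<circ> \<kappa> \<and> \<kappa>' \<circ> (g \<circ> \<beta>) = (g \<circ> \<beta>) \<circ> \<kappa>'"
proof -
  let ?r = "twisted_union u v f \<alpha> g \<beta>"
  let ?w = "map_prod id (map_sum \<kappa> \<kappa>')"
  let ?eq = "\<lambda>p. ?r (?w (?r (?w p))) = ?w (?r (?w (?r p)))"
  have refl_u: "u (map_prod id \<kappa> (u (map_prod id \<kappa> p))) = map_prod id \<kappa> (u (map_prod id \<kappa> (u p)))"
    and refl_v: "v (map_prod id \<kappa>' (v (map_prod id \<kappa>' q))) = map_prod id \<kappa>' (v (map_prod id \<kappa>' (v q)))"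
    for p q
    using assms(2,3) by (simp_all add: reflection_iff del: split_paired_All)
  have comm: "g (\<beta> b) = \<beta> (g b)" for b
    using assms(1) by (auto simp: twisted_union_data_def fun_eq_iff)
  have r_Inl: "?r (map_prod Inl Inl p) = map_prod Inl Inl (u p)"
    and r_Inr: "?r (map_prod Inr Inr q) = map_prod Inr Inr (v q)" for p q
    by (cases p, simp) (cases q, simp)
  have w_Inl: "?w (map_prod Inl Inl p) = map_prod Inl Inl (map_prod id \<kappa> p)"
    and w_Inr: "?w (map_prod Inr Inr q) = map_prod Inr Inr (map_prod id \<kappa>' q)" for p q
    by (cases p, simp) (cases q, simp)
  have pure_map: "?eq (map_prod Inl Inl p)" "?eq (map_prod Inr Inr q)" for p q
    by (simp_all only: r_Inl w_Inl refl_u r_Inr w_Inr refl_v)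
  have pure: "?eq (Inl a, Inl a')" "?eq (Inr b, Inr b')" for a a' b b'
    using pure_map(1)[of "(a, a')"] pure_map(2)[of "(b, b')"] by (simp_all only: map_prod_simp)
  have mixed: "?eq (Inl a, Inr b) \<longleftrightarrow> \<kappa>' (\<beta> (g b)) = \<beta> (g (\<kappa>' b))"
    "?eq (Inr b, Inl a) \<longleftrightarrow> \<kappa> (f (\<alpha> a)) = f (\<alpha> (\<kappa> a))" for a b
    by auto
  have "reflection ?r (map_sum \<kappa> \<kappa>') \<longleftrightarrow>
      (\<forall>a b. ?eq (Inl a, Inr b)) \<and> (\<forall>a b. ?eq (Inr b, Inl a))"
    unfolding reflection_iff
  proof
    assume eq: "\<forall>p. ?eq p"
    show "(\<forall>a b. ?eq (Inl a, Inr b)) \<and> (\<forall>a b. ?eq (Inr b, Inl a))"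
      by (intro conjI allI eq[THEN spec])
  next
    assume eq: "(\<forall>a b. ?eq (Inl a, Inr b)) \<and> (\<forall>a b. ?eq (Inr b, Inl a))"
    have "?eq (x, y)" for x y
      by (cases x; cases y; hypsubst;
          rule pure eq[THEN conjunct1, rule_format] eq[THEN conjunct2, rule_format])
    then show "\<forall>p. ?eq p"
      by (simp only: split_paired_All) blast
  qed
  \<comment> \<open>Each mixed condition involves only the second argument of the pair. As \<open>X\<close> and \<open>Y\<close> are
      nonempty, the quantifier over the first one can be dropped.\<close>
  also have "\<dots> \<longleftrightarrow> (\<forall>b. \<kappa>' (\<beta> (g b)) = \<beta> (g (\<kappa>' b))) \<and> (\<forall>a. \<kappa> (f (\<alpha> a)) = f (\<alpha> (\<kappa> a)))"
    unfolding mixed by simp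
  also have "\<dots> \<longleftrightarrow> \<kappa> \<circ> (f \<circ> \<alpha>) = (f \<circ> \<alpha>) \<circ> \<kappa> \<and> \<kappa>' \<circ> (g \<circ> \<beta>) = (g \<circ> \<beta>) \<circ> \<kappa>'"
    by (auto simp: fun_eq_iff comm)
  finally show ?thesis .
qed

end
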